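(* Let $P$ and $Q$ be finite posets and let $f:P\to Q$ be a surjective order-preserving map such that for every $q\in Q$ and every $p\in f^{-1}(q)$ the image of $P_{<p}$ under $f$ equals $Q_{<q}$, i.e. $f(P_{<p})=Q_{<q}$. Then $$\mu(Q)=\mu(P)+\sum_{q\in Q}\mu(Q_{<q})\,\mu\big(f^{-1}(Q_{\ge q})\big).$$
   Context: For a poset $P$ and $p\in P$, $P_{<p}=\{x\in P: x<p\}$ and $P_{\ge p}=\{x\in P:x\ge p\}$. For a finite poset $P$ (possibly empty), $\mu(P)$ denotes the Möbius function value $\mu_{\hat P}(\hat 0,\hat 1)$, where $\hat P$ is $P$ with a new bottom element $\hat 0$ and a new top element $\hat 1$ adjoined; in particular $\mu(\emptyset)=-1$. (Equivalently $\mu(P)$ is the reduced Euler characteristic of the order complex of $P$.) Subsets such as $Q_{<q}$ and $f^{-1}(Q_{\ge q})$ carry the induced order. The Möbius function is given by $\mu(a,a)=1$ and $\mu(a,b)=-\sum_{a\le z<b}\mu(a,z)$ for $a<b$. *)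

theory Defs
  imports Main
begin

text \<open>
  A poset is a carrier set \<open>A\<close> together with a relation \<open>r\<close> such that \<open>partial_order_on A r\<close>.
  The guard in the following definition is needed only for termination. For \<open>a \<le> b\<close> in
  a finite poset the recursion is the usual one (see \<open>mobius_fn_refl\<close> and \<open>mobius_fn_less\<close>
  below); in all other cases the value is 0.
\<close>

function mobius_fn :: "'a set \<Rightarrow> 'a rel \<Rightarrow> 'a \<Rightarrow> 'a \<Rightarrow> int" where
  "mobius_fn A r a b =
     (if finite A \<and> partial_order_on A r \<and> (a, b) \<in> r
      then if a = b then 1
           else - (\<Sum>z \<in> {z \<in> A. (a, z) \<in> r \<and> (z, b) \<in> r \<and> z \<noteq> b}. mobius_fn A r a z)
      else 0)"
  by pat_completeness auto
termination
proof (relation "measure (\<lambda>(A, r, a, b). card {z \<in> A. (z, b) \<in> r})", goal_cases)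
  case 1
  then show ?case by simp
next
  case (2 A r a b z)
  then have fin: "finite A" and po: "partial_order_on A r"
    and z: "z \<in> A" "(z, b) \<in> r" "z \<noteq> b"
    by auto
  from po have r: "r \<subseteq> A \<times> A" "refl_on A r" "trans r" "antisym r"
    by (auto simp: order_on_defs)
  have "b \<in> A" using z r by auto
  then have "{y \<in> A. (y, z) \<in> r} \<subset> {y \<in> A. (y, b) \<in> r}"
    using z r by (auto dest: transD antisymD refl_onD)
  then show ?case using fin by (simp add: psubset_card_mono)
qed

declare mobius_fn.simps [simp del]

lemma mobius_fn_refl:
  assumes "finite A" "partial_order_on A r" "a \<in> A"
  shows "mobius_fn A r a a = 1"
  using assms by (subst mobius_fn.simps) (auto simp: order_on_defs dest: refl_onD)

lemma mobius_fn_less: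
  assumes "finite A" "partial_order_on A r" "(a, b) \<in> r" "a \<noteq> b"
  shows "mobius_fn A r a b =
    - (\<Sum>z \<in> {z \<in> A. (a, z) \<in> r \<and> (z, b) \<in> r \<and> z \<noteq> b}. mobius_fn A r a z)"
  using assms by (subst mobius_fn.simps) simp

datatype 'a hat = Bot | El 'a | Top

definition hat_set :: "'a set \<Rightarrow> 'a hat set" where
  "hat_set A = {Bot, Top} \<union> El ` A"

definition hat_rel :: "'a set \<Rightarrow> 'a rel \<Rightarrow> 'a hat rel" where
  "hat_rel A r = {Bot} \<times> hat_set A \<union> hat_set A \<times> {Top} \<union> {(El x, El y) |x y. (x, y) \<in> r}"

lemma finite_hat_set [simp]: "finite (hat_set A) \<longleftrightarrow> finite A"
  by (auto simp: hat_set_def dest: finite_imageD intro: inj_onI)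

lemma partial_order_on_hat:
  assumes "partial_order_on A r"
  shows "partial_order_on (hat_set A) (hat_rel A r)"
proof -
  from assms have r: "r \<subseteq> A \<times> A" "refl_on A r" "trans r" "antisym r"
    by (auto simp: order_on_defs)
  have "hat_rel A r \<subseteq> hat_set A \<times> hat_set A"
    using r by (auto simp: hat_rel_def hat_set_def)
  moreover have "refl_on (hat_set A) (hat_rel A r)"
    using r by (auto simp: hat_rel_def hat_set_def refl_on_def)
  moreover have "trans (hat_rel A r)"
    using r by (intro transI) (auto simp: hat_rel_def hat_set_def dest: transD)
  moreover have "antisym (hat_rel A r)"
    using r by (intro antisymI) (auto simp: hat_rel_def hat_set_def dest: antisymD)
  ultimately show ?thesis by (simp add: order_on_defs)
qed

definition mobius_number :: "'a set \<Rightarrow> 'a rel \<Rightarrow> int" where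
  "mobius_number A r = mobius_fn (hat_set A) (hat_rel A r) Bot Top"

lemma mobius_number_empty: "mobius_number ({} :: 'a set) {} = -1"
proof -
  define A :: "'a hat set" where "A = hat_set {}"
  define r :: "'a hat rel" where "r = hat_rel {} {}"
  have fin: "finite A" by (simp add: A_def)
  have po: "partial_order_on A r"
    unfolding A_def r_def
    by (rule partial_order_on_hat) (simp add: order_on_defs refl_on_def)
  have "{z \<in> A. (Bot, z) \<in> r \<and> (z, Top) \<in> r \<and> z \<noteq> Top} = {Bot}" and "(Bot, Top) \<in> r"
    by (auto simp: A_def r_def hat_set_def hat_rel_def)
  moreover have "mobius_fn A r Bot Bot = 1"
    using fin po by (intro mobius_fn_refl) (auto simp: A_def hat_set_def)
  ultimately have "mobius_fn A r Bot Top = -1"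
    using mobius_fn_less[OF fin po, of Bot Top] by simp
  then show ?thesis by (simp add: mobius_number_def A_def r_def)
qed

text \<open>The value of a subset \<open>S\<close> of a poset with order \<open>r\<close>, taken with the induced order.\<close>

definition mobius_sub :: "'a rel \<Rightarrow> 'a set \<Rightarrow> int" where
  "mobius_sub r S = mobius_number S (Restr r S)"

end

theory Submission
  imports Defs
begin

text \<open>
  Splitting the defining sum of the Moebius function gives the recursion
  \<open>\<mu>(S) = - 1 - (\<Sum>x\<in>S. \<mu>(S\<^bsub><x\<^esub>))\<close>. Apply it to \<open>\<mu>(P)\<close> and to each
  \<open>\<mu>(f\<^sup>-\<^sup>1(Q\<^bsub>\<ge>q\<^esub>))\<close>, and exchange the sums over \<open>p\<close> and \<open>q\<close>. The terms belonging to a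
  fixed \<open>p\<close> form the right-hand side of the formula for the restriction
  \<open>P\<^bsub><p\<^esub> \<rightarrow> Q\<^bsub>\<le>f p\<^esub>\<close> of \<open>f\<close>, so by induction they add up to
  \<open>\<mu>(Q\<^bsub>\<le>f p\<^esub>)\<close>, which is 0 because \<open>Q\<^bsub>\<le>f p\<^esub>\<close> has a greatest element. What remains is the
  recursion for \<open>\<mu>(Q)\<close>.
\<close>

text \<open>The half-open intervals starting at \<open>Bot\<close> have this index set:
  \<open>B\<close> is \<open>underS r x\<close> for the interval up to \<open>El x\<close>, and
  \<open>A\<close> for the one up to \<open>Top\<close>.\<close>

lemma sum_mobius_fn_hat:
  assumes "finite A" and "partial_order_on A r" and "finite B"
  shows "(\<Sum>z\<in>insert Bot (El ` B). mobius_fn (hat_set A) (hat_rel A r) Bot z) =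
    1 + (\<Sum>x\<in>B. mobius_fn (hat_set A) (hat_rel A r) Bot (El x))"
proof -
  have "Bot \<in> hat_set A"
    by (simp add: hat_set_def)
  then show ?thesis
    using assms
    by (subst sum.insert)
      (auto simp: sum.reindex inj_on_def mobius_fn_refl partial_order_on_hat)
qed

lemma mobius_fn_hat_El:
  assumes fin: "finite A" and po: "partial_order_on A r" and x: "x \<in> A"
  shows "mobius_fn (hat_set A) (hat_rel A r) Bot (El x) =
    - 1 - (\<Sum>y\<in>underS r x. mobius_fn (hat_set A) (hat_rel A r) Bot (El y))"
proof -
  have sub: "r \<subseteq> A \<times> A"
    using po by (simp add: order_on_defs)
  have iv: "{z \<in> hat_set A. (Bot, z) \<in> hat_rel A r \<and> (z, El x) \<in> hat_rel A r \<and> z \<noteq> El x} =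
      insert Bot (El ` underS r x)"
    using sub x by (auto simp: hat_set_def hat_rel_def underS_def)
  have "finite (underS r x)"
    using fin sub by (auto simp: underS_def intro: finite_subset[of _ A])
  then have "(\<Sum>z\<in>insert Bot (El ` underS r x). mobius_fn (hat_set A) (hat_rel A r) Bot z) =
      1 + (\<Sum>y\<in>underS r x. mobius_fn (hat_set A) (hat_rel A r) Bot (El y))"
    using fin po by (intro sum_mobius_fn_hat) auto
  moreover have "(Bot, El x) \<in> hat_rel A r"
    using x by (simp add: hat_rel_def hat_set_def)
  ultimately show ?thesis
    using fin po by (simp add: mobius_fn_less partial_order_on_hat iv)
qed

lemma mobius_number_eq_sum_mobius_fn:
  assumes fin: "finite A" and po: "partial_order_on A r"
  shows "mobius_number A r = - 1 - (\<Sum>x\<in>A. mobius_fn (hat_set A) (hat_rel A r) Bot (El x))"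
proof -
  have iv: "{z \<in> hat_set A. (Bot, z) \<in> hat_rel A r \<and> (z, Top) \<in> hat_rel A r \<and> z \<noteq> Top} =
      insert Bot (El ` A)"
    by (auto simp: hat_set_def hat_rel_def)
  have "(\<Sum>z\<in>insert Bot (El ` A). mobius_fn (hat_set A) (hat_rel A r) Bot z) =
      1 + (\<Sum>x\<in>A. mobius_fn (hat_set A) (hat_rel A r) Bot (El x))"
    using fin po by (intro sum_mobius_fn_hat) auto
  moreover have "(Bot, Top) \<in> hat_rel A r"
    by (simp add: hat_rel_def hat_set_def)
  ultimately show ?thesis
    using fin po by (simp add: mobius_number_def mobius_fn_less partial_order_on_hat iv)
qed

lemma partial_order_on_Restr:
  assumes "partial_order_on A r" and "B \<subseteq> A"
  shows "partial_order_on B (Restr r B)"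
  using assms unfolding order_on_defs refl_on_def trans_def antisym_def by blast

text \<open>By its recursion, the value at \<open>El x\<close> involves only elements below
  \<open>x\<close>, and a down-closed \<open>D\<close> containing \<open>x\<close> contains all of
  them.\<close>

lemma mobius_fn_hat_El_Restr:
  assumes fin: "finite A" and po: "partial_order_on A r" and D: "D \<subseteq> A"
    and down: "\<And>x y. x \<in> D \<Longrightarrow> (y, x) \<in> r \<Longrightarrow> y \<in> D"
    and "x \<in> D"
  shows "mobius_fn (hat_set D) (hat_rel D (Restr r D)) Bot (El x) =
    mobius_fn (hat_set A) (hat_rel A r) Bot (El x)"
  using \<open>x \<in> D\<close>
proof (induction "card (underS r x)" arbitrary: x rule: less_induct)
  case less
  have r: "r \<subseteq> A \<times> A" "trans r" "antisym r"
    using po by (auto simp: order_on_defs)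
  have under: "underS (Restr r D) x = underS r x"
    using less.prems down by (auto simp: underS_def)
  have "mobius_fn (hat_set D) (hat_rel D (Restr r D)) Bot (El y) =
      mobius_fn (hat_set A) (hat_rel A r) Bot (El y)" if y: "y \<in> underS r x" for y
  proof (rule less.hyps)
    have "underS r y \<subset> underS r x"
      using y r by (auto simp: underS_def dest: transD antisymD)
    moreover have "finite (underS r x)"
      using fin r by (auto simp: underS_def intro: finite_subset[of _ A])
    ultimately show "card (underS r y) < card (underS r x)"
      by (rule psubset_card_mono[rotated])
    show "y \<in> D"
      using y less.prems down by (auto simp: underS_def)
  qed
  moreover have "finite D" "x \<in> A"
    using fin D less.prems by (auto intro: finite_subset)
  ultimately show ?case
    using fin po D less.prems by (simp add: mobius_fn_hat_El partial_order_on_Restr under)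
qed

text \<open>In the hat of \<open>underS r x\<close>, the element \<open>Top\<close> sits above the
  same elements as \<open>El x\<close> does in the hat of \<open>A\<close>. As
  \<open>underS r x\<close> is down-closed, the values below agree, so the two recursions give the
  same number.\<close>

lemma mobius_number_rec:
  assumes fin: "finite A" and po: "partial_order_on A r"
  shows "mobius_number A r = - 1 - (\<Sum>x\<in>A. mobius_sub r (underS r x))"
proof -
  have r: "r \<subseteq> A \<times> A" "trans r" "antisym r"
    using po by (auto simp: order_on_defs)
  have "mobius_fn (hat_set A) (hat_rel A r) Bot (El x) = mobius_sub r (underS r x)"
    if "x \<in> A" for x
  proof -
    have sub: "underS r x \<subseteq> A"
      using r by (auto simp: underS_def)
    have down: "z \<in> underS r x" if "y \<in> underS r x" "(z, y) \<in> r" for y z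
      using that r by (auto simp: underS_def dest: transD antisymD)
    have "mobius_fn (hat_set (underS r x)) (hat_rel (underS r x) (Restr r (underS r x)))
          Bot (El y) =
        mobius_fn (hat_set A) (hat_rel A r) Bot (El y)" if "y \<in> underS r x" for y
      by (rule mobius_fn_hat_El_Restr[OF fin po sub _ that]) (rule down)
    then have "mobius_sub r (underS r x) =
        - 1 - (\<Sum>y\<in>underS r x. mobius_fn (hat_set A) (hat_rel A r) Bot (El y))"
      using fin po sub
      by (simp add: mobius_sub_def mobius_number_eq_sum_mobius_fn partial_order_on_Restr
          finite_subset)
    then show ?thesis
      using mobius_fn_hat_El[OF fin po that] by simp
  qed
  then show ?thesis
    using fin po by (simp add: mobius_number_eq_sum_mobius_fn)
qed

text \<open>Keeps the one ambient order \<open>r\<close> on both sides, so that repeated use never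
  nests restrictions.\<close>

lemma mobius_sub_rec:
  assumes "finite A" and "partial_order_on A r" and "S \<subseteq> A"
  shows "mobius_sub r S = - 1 - (\<Sum>x\<in>S. mobius_sub r (S \<inter> underS r x))"
proof -
  have "mobius_sub (Restr r S) (underS (Restr r S) x) = mobius_sub r (S \<inter> underS r x)"
    if "x \<in> S" for x
  proof -
    have "underS (Restr r S) x = S \<inter> underS r x"
      using that by (auto simp: underS_def)
    moreover have "Restr (Restr r S) (S \<inter> underS r x) = Restr r (S \<inter> underS r x)"
      by blast
    ultimately show ?thesis
      by (simp add: mobius_sub_def)
  qed
  then show ?thesis
    using assms mobius_number_rec[of S "Restr r S"]
    by (simp add: mobius_sub_def[of r S] partial_order_on_Restr finite_subset)
qed

text \<open>In the recursion for \<open>S\<close> the term of \<open>t\<close> is the value of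
  \<open>S - {t}\<close>. By the recursion for \<open>S - {t}\<close>, the remaining terms cancel it
  together with the constant.\<close>

lemma mobius_sub_greatest:
  assumes fin: "finite A" and po: "partial_order_on A r" and S: "S \<subseteq> A"
    and t: "t \<in> S" and max: "\<And>x. x \<in> S \<Longrightarrow> (x, t) \<in> r"
  shows "mobius_sub r S = 0"
proof -
  define U where "U = S - {t}"
  have U: "U \<subseteq> A" "finite S"
    using fin S t by (auto simp: U_def intro: finite_subset)
  have anti: "antisym r"
    using po by (simp add: order_on_defs)
  have top: "S \<inter> underS r t = U"
    using max by (auto simp: U_def underS_def)
  \<comment> \<open>Removing \<open>t\<close> leaves the strict lower sets of the other elements
    unchanged, since \<open>t\<close> lies strictly below none of them.\<close>
  have "S \<inter> underS r x = U \<inter> underS r x" if "x \<in> U" for x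
    using that max anti by (auto simp: U_def underS_def dest: antisymD)
  then have "(\<Sum>x\<in>U. mobius_sub r (S \<inter> underS r x)) = - 1 - mobius_sub r U"
    using mobius_sub_rec[OF fin po U(1)] by simp
  moreover have "(\<Sum>x\<in>S. mobius_sub r (S \<inter> underS r x)) =
      mobius_sub r (S \<inter> underS r t) + (\<Sum>x\<in>U. mobius_sub r (S \<inter> underS r x))"
    using U(2) t by (simp add: sum.remove flip: U_def)
  ultimately show ?thesis
    using mobius_sub_rec[OF fin po S] top by simp
qed

lemma mobius_sub_fibre_formula:
  assumes finP: "finite P" and poP: "partial_order_on P leP"
    and finQ: "finite Q" and poQ: "partial_order_on Q leQ"
    and mono: "\<And>x y. (x, y) \<in> leP \<Longrightarrow> (f x, f y) \<in> leQ"
    and "S \<subseteq> P" and "T \<subseteq> Q" and "f ` S \<subseteq> T"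
  shows "mobius_sub leQ T =
    mobius_sub leP S +
      (\<Sum>q\<in>T. mobius_sub leQ (T \<inter> underS leQ q) * mobius_sub leP {p \<in> S. f p \<in> above leQ q})"
  using \<open>S \<subseteq> P\<close> \<open>T \<subseteq> Q\<close> \<open>f ` S \<subseteq> T\<close>
proof (induction "card S" arbitrary: S T rule: less_induct)
  case less
  define F where "F q = {p \<in> S. f p \<in> above leQ q}" for q
  define m where "m q = mobius_sub leQ (T \<inter> underS leQ q)" for q
  have rP: "leP \<subseteq> P \<times> P" "trans leP" "antisym leP"
    using poP by (auto simp: order_on_defs)
  have rQ: "leQ \<subseteq> Q \<times> Q" "refl_on Q leQ" "trans leQ" "antisym leQ"
    using poQ by (auto simp: order_on_defs)
  have finS: "finite S" and finT: "finite T"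
    using less.prems finP finQ by (auto intro: finite_subset)
  have zero: "mobius_sub leP (S \<inter> underS leP p) +
      (\<Sum>q\<in>{q \<in> T. f p \<in> above leQ q}. m q * mobius_sub leP (F q \<inter> underS leP p)) = 0"
    if p: "p \<in> S" for p
  proof -
    define S' where "S' = S \<inter> underS leP p"
    define T' where "T' = {q \<in> T. f p \<in> above leQ q}"
    have "p \<notin> S'"
      by (simp add: S'_def underS_def)
    then have "card S' < card S"
      using finS p by (intro psubset_card_mono) (auto simp: S'_def)
    moreover have "S' \<subseteq> P" "T' \<subseteq> Q"
      using less.prems by (auto simp: S'_def T'_def)
    moreover have "f ` S' \<subseteq> T'"
      using less.prems mono by (auto simp: S'_def T'_def underS_def above_def)
    ultimately have IH: "mobius_sub leQ T' = mobius_sub leP S' +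
        (\<Sum>q\<in>T'. mobius_sub leQ (T' \<inter> underS leQ q) *
          mobius_sub leP {x \<in> S'. f x \<in> above leQ q})"
      by (rule less.hyps)
    have "f p \<in> T" "f p \<in> Q"
      using p less.prems by auto
    then have fp: "f p \<in> T'"
      using rQ by (simp add: T'_def above_def refl_onD)
    \<comment> \<open>\<open>f p\<close> is the greatest element of \<open>T'\<close>.\<close>
    have "mobius_sub leQ T' = 0"
      using finQ poQ \<open>T' \<subseteq> Q\<close> fp
      by (rule mobius_sub_greatest) (simp add: T'_def above_def)
    \<comment> \<open>\<open>T'\<close> is down-closed in \<open>T\<close>, so the coefficients in
      the induction hypothesis are the same \<open>m q\<close> as for \<open>T\<close>.\<close>
    moreover have "T' \<inter> underS leQ q = T \<inter> underS leQ q" if "q \<in> T'" for q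
      using that rQ by (auto simp: T'_def above_def underS_def dest: transD)
    moreover have "{x \<in> S'. f x \<in> above leQ q} = F q \<inter> underS leP p" for q
      by (auto simp: S'_def F_def)
    ultimately show ?thesis
      using IH by (simp add: m_def flip: S'_def T'_def)
  qed
  have "F q \<subseteq> P" for q
    using less.prems by (auto simp: F_def)
  note recF = mobius_sub_rec[OF finP poP this]
  \<comment> \<open>Expanding each \<open>F q\<close> by its recursion, the constant -1 yields
    \<open>- m q\<close>; these terms later rebuild the recursion for \<open>T\<close>.\<close>
  have "(\<Sum>q\<in>T. m q * mobius_sub leP (F q)) =
      (\<Sum>q\<in>T. - m q - (\<Sum>p\<in>F q. m q * mobius_sub leP (F q \<inter> underS leP p)))"
    by (subst recF) (simp add: algebra_simps sum_distrib_left)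
  also have "\<dots> = - (\<Sum>q\<in>T. m q) -
      (\<Sum>q\<in>T. \<Sum>p\<in>F q. m q * mobius_sub leP (F q \<inter> underS leP p))"
    by (simp add: sum_subtractf sum_negf)
  \<comment> \<open>Both sides run over the pairs with \<open>q\<close> in \<open>T\<close>,
    \<open>p\<close> in \<open>S\<close> and \<open>q\<close> weakly below \<open>f p\<close>;
    grouping by \<open>p\<close> produces the inner sums evaluated in \<open>zero\<close>.\<close>
  also have "(\<Sum>q\<in>T. \<Sum>p\<in>F q. m q * mobius_sub leP (F q \<inter> underS leP p)) =
      (\<Sum>p\<in>S. \<Sum>q\<in>{q \<in> T. f p \<in> above leQ q}. m q * mobius_sub leP (F q \<inter> underS leP p))"
    unfolding F_def by (rule sum.swap_restrict[OF finT finS])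
  also have "\<dots> = (\<Sum>p\<in>S. - mobius_sub leP (S \<inter> underS leP p))"
    using zero by (intro sum.cong) (auto simp: add_eq_0_iff)
  also have "\<dots> = 1 + mobius_sub leP S"
    using mobius_sub_rec[OF finP poP \<open>S \<subseteq> P\<close>] by (simp add: sum_negf)
  finally have "(\<Sum>q\<in>T. m q * mobius_sub leP (F q)) = - (\<Sum>q\<in>T. m q) - (1 + mobius_sub leP S)" .
  moreover have "mobius_sub leQ T = - 1 - (\<Sum>q\<in>T. m q)"
    unfolding m_def by (rule mobius_sub_rec[OF finQ poQ \<open>T \<subseteq> Q\<close>])
  ultimately show ?case
    by (simp add: m_def F_def)
qed

theorem proposition22:
  fixes P :: "'a set" and leP :: "'a rel"
    and Q :: "'b set" and leQ :: "'b rel"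
    and f :: "'a \<Rightarrow> 'b"
  assumes "finite P" and "partial_order_on P leP"
    and "finite Q" and "partial_order_on Q leQ"
    and surj: "f ` P = Q"
    and mono: "\<And>x y. (x, y) \<in> leP \<Longrightarrow> (f x, f y) \<in> leQ"
    and below: "\<And>q p. q \<in> Q \<Longrightarrow> p \<in> P \<Longrightarrow> f p = q \<Longrightarrow> f ` underS leP p = underS leQ q"
  shows "mobius_number Q leQ =
    mobius_number P leP +
      (\<Sum>q\<in>Q. mobius_sub leQ (underS leQ q) * mobius_sub leP {p \<in> P. f p \<in> above leQ q})"
proof -
  have sub: "leP \<subseteq> P \<times> P" "leQ \<subseteq> Q \<times> Q"
    using assms(2,4) by (auto simp: order_on_defs)
  \<comment> \<open>An order on a carrier lies inside its square, so restricting it to the whole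
    carrier changes nothing.\<close>
  then have whole: "mobius_number P leP = mobius_sub leP P" "mobius_number Q leQ = mobius_sub leQ Q"
    by (auto simp: mobius_sub_def inf.absorb1)
  have "Q \<inter> underS leQ q = underS leQ q" for q
    using sub by (auto simp: underS_def)
  then show ?thesis
    using mobius_sub_fibre_formula[OF assms(1-4) mono subset_refl subset_refl] surj
    by (simp add: whole)
qed

end
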